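(* Let $L\in\mathbb R^{N\times N}$ be the graph Laplacian of a weighted directed graph on $N$ vertices that contains a directed spanning tree. Let $p_1,p_2,p_3>0$, let $d\in\mathbb R^N$ be constant, and put $a_{\mathrm v}=p_1+p_2+p_3$, $a_{\mathrm p}=p_1p_2+p_1p_3+p_2p_3$, $a_{\mathrm I}=p_1p_2p_3$. Consider the third-order serial consensus system for $x(t),z(t)\in\mathbb R^N$, $t\ge 0$, with arbitrary initial values $x(0),\dot x(0),z(0)$: $$\begin{aligned}\dot z&=L\cdot L(x-d),\\ \ddot x&=-a_{\mathrm v}L\dot x-a_{\mathrm p}L^2(x-d)-a_{\mathrm I}Lz+w,\end{aligned}$$ equivalently, in terms of the state $\xi(t)=[z^\top,(L(x-d))^\top,\dot x^\top]^\top\in\mathbb R^{3N}$, $$\dot\xi=\begin{bmatrix}0&L&0\\ 0&0&L\\ -a_{\mathrm I}L&-a_{\mathrm p}L&-a_{\mathrm v}L\end{bmatrix}\xi+\begin{bmatrix}0\\ 0\\ w\end{bmatrix},$$ where the disturbance is $w(t)=Lw_0$ with $w_0\in\mathbb R^N$ constant. Then $L(x(t)-d)\to 0$ and $L\dot x(t)\to 0$ as $t\to\infty$, and $$\sup_{t\ge 0}\|\xi(t)\|_\infty\le \alpha_\xi(p)\,\|\xi(0)\|_\infty+\alpha_w(p)\,\|w_0\|_\infty,$$ with $$\alpha_w(p)=\frac{2}{p_1p_2p_3}\,\|S_1\|_\infty\,\left\|S_1^{-1}[1,0,0]^\top\right\|_\infty,\qquad \alpha_\xi(p)=\|S_2\|_\infty\,\|S_2^{-1}\|_\infty,$$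 where $S_1,S_2$ are any invertible $3\times 3$ matrices that diagonalize (i.e. $S_i^{-1}AS_i$ is diagonal for $i=1,2$) the matrix $$A=\begin{bmatrix}0&1&0\\ 0&0&1\\ -a_{\mathrm I}&-a_{\mathrm p}&-a_{\mathrm v}\end{bmatrix}.$$
   Context: Graph Laplacian: a weighted directed graph with vertex set $\mathcal V$, $|\mathcal V|=N$, and edge set $\mathcal E\subset\mathcal V\times\mathcal V$ is represented by its weighted adjacency matrix $W\in\mathbb R^{N\times N}$, which has nonnegative entries with $w_{ij}>0$ if and only if $(j,i)\in\mathcal E$ (and $w_{ij}=0$ otherwise). Its graph Laplacian is $L=D-W$ with $D=\mathrm{diag}(W\mathbf 1)$, where $\mathbf 1$ is the all-ones vector. The graph contains a directed spanning tree if, for some vertex $i$, there is a directed path from $i$ to every other vertex $j\in\mathcal V\setminus\{i\}$. Norms: for a vector $x$, $\|x\|_\infty=\max_i|x_i|$; for a matrix $C$, $\|C\|_\infty=\max_i\sum_j|C_{ij}|$ is the induced matrix norm. *)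

theory Defs
  imports "HOL-Analysis.Analysis"
begin

definition is_weighted_adjacency :: "('n::finite \<times> 'n) set \<Rightarrow> real^'n^'n \<Rightarrow> bool" where
  "is_weighted_adjacency E W \<longleftrightarrow>
     (\<forall>i j. W $ i $ j \<ge> 0) \<and> (\<forall>i j. W $ i $ j > 0 \<longleftrightarrow> (j, i) \<in> E)"

definition diag_matrix :: "real^'n \<Rightarrow> real^'n^'n" where
  "diag_matrix v = (\<chi> i j. if i = j then v $ i else 0)"

(* 1 is the all-ones vector here, see one_vec_def *)
definition graph_laplacian :: "real^'n^'n \<Rightarrow> real^'n^'n" where
  "graph_laplacian W = diag_matrix (W *v 1) - W"

definition has_directed_spanning_tree :: "('n \<times> 'n) set \<Rightarrow> bool" where
  "has_directed_spanning_tree E \<longleftrightarrow> (\<exists>i. \<forall>j. j \<noteq> i \<longrightarrow> (i, j) \<in> E\<^sup>+)"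

(* infnorm from HOL-Analysis is restricted to euclidean spaces and, on complex vectors, measures
   real and imaginary parts separately; on real vectors both notions agree, see below. *)
definition vec_norm_inf :: "('a::real_normed_vector)^'n \<Rightarrow> real" where
  "vec_norm_inf x = Max (range (\<lambda>i. norm (x $ i)))"

definition mat_norm_inf :: "('a::real_normed_vector)^'n^'m \<Rightarrow> real" where
  "mat_norm_inf C = Max (range (\<lambda>i. \<Sum>j\<in>UNIV. norm (C $ i $ j)))"

lemma vec_norm_inf_eq_infnorm: "vec_norm_inf x = infnorm x" for x :: "real^'n"
proof -
  have "{\<bar>x $ i\<bar> |i. i \<in> UNIV} = range (\<lambda>i. \<bar>x $ i\<bar>)" by auto
  then show ?thesis
    by (simp add: vec_norm_inf_def infnorm_cart cSup_eq_Max)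
qed

definition diagonalizes :: "('a::field)^'n^'n \<Rightarrow> 'a^'n^'n \<Rightarrow> bool" where
  "diagonalizes S M \<longleftrightarrow>
     invertible S \<and> (\<forall>i j. i \<noteq> j \<longrightarrow> (matrix_inv S ** M ** S) $ i $ j = 0)"

definition companion3 :: "real \<Rightarrow> real \<Rightarrow> real \<Rightarrow> real^3^3" where
  "companion3 aI ap av = vector [vector [0, 1, 0], vector [0, 0, 1], vector [- aI, - ap, - av]]"

definition stack3 :: "real^'n \<Rightarrow> real^'n \<Rightarrow> real^'n \<Rightarrow> real^('n + 'n + 'n)" where
  "stack3 a b c =
     (\<chi> k. case k of Inl i \<Rightarrow> a $ i | Inr (Inl i) \<Rightarrow> b $ i | Inr (Inr i) \<Rightarrow> c $ i)"

(* v is the velocity of x; the derivatives at time 0 are one-sided. *)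
definition third_order_serial_consensus ::
  "real^'n^'n \<Rightarrow> real \<Rightarrow> real \<Rightarrow> real \<Rightarrow> real^'n \<Rightarrow> (real \<Rightarrow> real^'n) \<Rightarrow>
   (real \<Rightarrow> real^'n) \<Rightarrow> (real \<Rightarrow> real^'n) \<Rightarrow> (real \<Rightarrow> real^'n) \<Rightarrow> bool" where
  "third_order_serial_consensus L aI ap av d w x v z \<longleftrightarrow>
     (\<forall>t\<ge>0.
        (z has_vector_derivative (L ** L) *v (x t - d)) (at t within {0..}) \<and>
        (x has_vector_derivative v t) (at t within {0..}) \<and>
        (v has_vector_derivative
           - (av *\<^sub>R (L *v v t)) - ap *\<^sub>R ((L ** L) *v (x t - d)) - aI *\<^sub>R (L *v z t) + w t)
          (at t within {0..}))"

definition consensus_state ::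
  "real^'n^'n \<Rightarrow> real^'n \<Rightarrow> (real \<Rightarrow> real^'n) \<Rightarrow> (real \<Rightarrow> real^'n) \<Rightarrow> (real \<Rightarrow> real^'n) \<Rightarrow>
   real \<Rightarrow> real^('n + 'n + 'n)" where
  "consensus_state L d x v z t = stack3 (z t) (L *v (x t - d)) (v t)"

end

theory Submission
  imports Defs
begin

text \<open>With \<open>zs = z - w0 / aI\<close> and \<open>y = L (x - d)\<close> the disturbance disappears, and every
  left eigenvector of the companion matrix, of eigenvalue \<open>-p\<close> with \<open>p \<in> {p1, p2, p3}\<close>,
  decouples a consensus flow \<open>u' = - p L u\<close>. Such a flow does not increase the maximum norm, so
  every solution of the homogeneous system stays within \<open>\<parallel>S\<parallel> \<parallel>S\<inverse> c(0)\<parallel>\<close>. The two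
  diagonalizing matrices are used separately, one on the solution starting at \<open>\<xi>(0)\<close> and one on
  the solution \<open>\<zeta>\<close> starting at \<open>(w0 / aI, 0, 0)\<close>.

  Convergence must not rely on diagonalizability, as the \<open>p\<close>'s may coincide. Instead, the
  factors are peeled off one at a time: \<open>a = v + (p1 + p2) y + p1 p2 zs\<close> and
  \<open>b = y + p1 zs\<close> satisfy \<open>a' = - p3 L a\<close>, \<open>b' = - p2 L b + L a\<close>,
  \<open>zs' = - p1 L zs + L b\<close>. A consensus flow with vanishing forcing reaches consensus, because the
  spanning tree makes the unit-time flow contract differences of entries.\<close>

subsection \<open>Forced consensus flows\<close>

text \<open>Values in an arbitrary normed space are allowed because eigencoordinates have entries in
  the field of the diagonalizing matrix. The differences \<open>u j t - u i t\<close> play the role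
  of minus the Laplacian. The forcing \<open>e\<close> is kept for the cascade used in the
  convergence proof.\<close>

definition diffuses ::
  "real^'n^'n \<Rightarrow> ('n::finite \<Rightarrow> real \<Rightarrow> 'b::real_normed_vector) \<Rightarrow> ('n \<Rightarrow> real \<Rightarrow> 'b) \<Rightarrow> bool" where
  "diffuses W u e \<longleftrightarrow>
     (\<forall>t\<ge>0. \<forall>i. (u i has_vector_derivative
        (\<Sum>j\<in>UNIV. W $ i $ j *\<^sub>R (u j t - u i t)) + e i t) (at t within {0..}))"

lemma diffuses_deriv:
  assumes "diffuses W u e" "t \<ge> 0"
  shows "(u i has_vector_derivative
     (\<Sum>j\<in>UNIV. W $ i $ j *\<^sub>R (u j t - u i t)) + e i t) (at t within {0..})"
  using assms by (auto simp: diffuses_def)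

lemma diffuses_deriv_at:
  assumes "diffuses W u e" "t > 0"
  shows "(u i has_vector_derivative
     (\<Sum>j\<in>UNIV. W $ i $ j *\<^sub>R (u j t - u i t)) + e i t) (at t)"
proof -
  have "at t within {0..} = at t"
    using assms(2) by (intro at_within_interior) (simp add: interior_Ici[of "-1"])
  with diffuses_deriv[OF assms(1), of t i] assms(2) show ?thesis by simp
qed

lemma diffuses_continuous_on:
  assumes "diffuses W u e"
  shows "continuous_on {0..} (u i)"
  unfolding continuous_on_eq_continuous_within
  by (auto intro!: has_vector_derivative_continuous diffuses_deriv[OF assms])

text \<open>Constants cancel in the differences \<open>u j t - u i t\<close>, so they may be added
  freely. The unforced summand \<open>h\<close> serves as a comparison flow.\<close>

lemma diffuses_affine:
  fixes u h :: "'n::finite \<Rightarrow> real \<Rightarrow> real"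
  assumes "diffuses W u e" "diffuses W h (\<lambda>_ _. 0)"
  shows "diffuses W (\<lambda>i t. a * u i t + b * h i t + c) (\<lambda>i t. a * e i t)"
  unfolding diffuses_def
proof (intro allI impI)
  fix t :: real and i assume t: "t \<ge> 0"
  show "((\<lambda>t. a * u i t + b * h i t + c) has_vector_derivative
      (\<Sum>j\<in>UNIV. W $ i $ j *\<^sub>R (a * u j t + b * h j t + c - (a * u i t + b * h i t + c))) +
      a * e i t) (at t within {0..})"
    by (rule derivative_eq_intros diffuses_deriv[OF assms(1) t] diffuses_deriv[OF assms(2) t]
         has_vector_derivative_mult_right refl)+
       (simp add: sum_distrib_left sum.distrib[symmetric] algebra_simps sum_subtractf[symmetric])
qed

lemma diffuses_shift:
  assumes "diffuses W u e" "T \<ge> 0"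
  shows "diffuses W (\<lambda>i t. u i (T + t)) (\<lambda>i t. e i (T + t))"
  unfolding diffuses_def
proof (intro allI impI)
  fix t :: real and i assume t: "t \<ge> 0"
  have "(u i has_vector_derivative
      (\<Sum>j\<in>UNIV. W $ i $ j *\<^sub>R (u j (T + t) - u i (T + t))) + e i (T + t))
      (at (T + t) within (+) T ` {0..})"
    by (rule has_vector_derivative_within_subset[OF diffuses_deriv[OF assms(1)]])
       (use t assms(2) in auto)
  moreover have "((+) T has_vector_derivative 1) (at t within {0..})"
    by (auto intro!: derivative_eq_intros)
  ultimately show "((\<lambda>t. u i (T + t)) has_vector_derivative
      (\<Sum>j\<in>UNIV. W $ i $ j *\<^sub>R (u j (T + t) - u i (T + t))) + e i (T + t)) (at t within {0..})"
    using vector_diff_chain_within[of "(+) T" 1 t "{0..}" "u i"] by (simp add: o_def)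
qed

text \<open>At a maximal excess of \<open>norm (u i t)\<close> over \<open>m + \<eta> * t\<close>, comparing
  \<open>exp (c * t) *\<^sub>R u i t\<close>, where \<open>c\<close> is the row sum, with
  \<open>exp (c * t) * (excess + m + \<eta> * t)\<close> shows that the excess is not positive.\<close>

lemma diffuses_norm_le:
  fixes u :: "'n::finite \<Rightarrow> real \<Rightarrow> 'b::real_normed_vector"
  assumes u: "diffuses W u e" and W: "\<And>i j. W $ i $ j \<ge> 0"
    and e: "\<And>i t. t \<ge> 0 \<Longrightarrow> norm (e i t) \<le> \<eta>"
    and m: "\<And>i. norm (u i 0) \<le> m"
    and t: "t \<ge> 0"
  shows "norm (u i t) \<le> m + \<eta> * t"
proof -
  define h where "h i s = norm (u i s) - (m + \<eta> * s)" for i s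
  have cont: "continuous_on {0..t} (u i)" for i
    by (rule continuous_on_subset[OF diffuses_continuous_on[OF u]]) auto
  have "\<exists>s\<in>{0..t}. \<forall>r\<in>{0..t}. h i r \<le> h i s" for i
    unfolding h_def using t by (intro continuous_attains_sup continuous_intros cont) auto
  then obtain s where s: "\<And>i. s i \<in> {0..t}" "\<And>i r. r \<in> {0..t} \<Longrightarrow> h i r \<le> h i (s i)"
    by metis
  define K where "K = Max (range (\<lambda>i. h i (s i)))"
  have "K \<in> range (\<lambda>i. h i (s i))" unfolding K_def by (intro Max_in) auto
  then obtain k where k: "K = h k (s k)" by auto
  have le_K: "h i r \<le> K" if "r \<in> {0..t}" for i r
    using s(2)[OF that, of i] unfolding K_def by (meson Max_ge finite order_trans rangeI finite_imageI)
  define c where "c = (\<Sum>j\<in>UNIV. W $ k $ j)"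
  have "K \<le> 0"
  proof (cases "s k = 0")
    case True
    with k m[of k] show ?thesis by (simp add: h_def)
  next
    case False
    with s(1)[of k] have s0: "0 < s k" and sk: "s k \<le> t" by auto
    let ?g = "\<lambda>r. exp (c * r) *\<^sub>R u k r"
    let ?g' = "\<lambda>r. exp (c * r) *\<^sub>R ((\<Sum>j\<in>UNIV. W $ k $ j *\<^sub>R u j r) + e k r)"
    let ?\<phi> = "\<lambda>r. exp (c * r) * (K + m + \<eta> * r)"
    let ?\<phi>' = "\<lambda>r. exp (c * r) * (c * (K + m + \<eta> * r) + \<eta>)"
    have "norm (?g (s k) - ?g 0) \<le> ?\<phi> (s k) - ?\<phi> 0"
    proof (rule differentiable_bound_general[OF s0, where f' = ?g' and \<phi>' = ?\<phi>'])
      show "continuous_on {0..s k} ?g"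
        by (intro continuous_intros continuous_on_subset[OF cont]) (use sk in auto)
      show "continuous_on {0..s k} ?\<phi>" by (intro continuous_intros)
      fix r assume r: "0 < r" "r < s k"
      have "(?g has_vector_derivative exp (c * r) *\<^sub>R
              ((\<Sum>j\<in>UNIV. W $ k $ j *\<^sub>R (u j r - u k r)) + e k r) + (exp (c * r) * c) *\<^sub>R u k r) (at r)"
        by (rule has_vector_derivative_scaleR[OF _ diffuses_deriv_at[OF u r(1)]])
           (auto intro!: derivative_eq_intros)
      also have "exp (c * r) *\<^sub>R ((\<Sum>j\<in>UNIV. W $ k $ j *\<^sub>R (u j r - u k r)) + e k r)
          + (exp (c * r) * c) *\<^sub>R u k r = ?g' r"
        by (simp add: c_def scaleR_diff_right sum_subtractf scaleR_sum_left[symmetric]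
            scaleR_add_right)
      finally show "(?g has_vector_derivative ?g' r) (at r)" .
      show "(?\<phi> has_vector_derivative ?\<phi>' r) (at r)"
        unfolding has_real_derivative_iff_has_vector_derivative[symmetric]
        by (auto intro!: derivative_eq_intros simp: algebra_simps)
      have "norm (u j r) \<le> K + m + \<eta> * r" for j
        using le_K[of r j] r sk by (simp add: h_def)
      then have "norm ((\<Sum>j\<in>UNIV. W $ k $ j *\<^sub>R u j r) + e k r) \<le>
          (\<Sum>j\<in>UNIV. W $ k $ j * (K + m + \<eta> * r)) + \<eta>"
        using e[of r k] r W
        by (intro norm_triangle_mono sum_norm_le) (auto intro!: mult_left_mono)
      then show "norm (?g' r) \<le> ?\<phi>' r"
        by (simp add: c_def sum_distrib_right)
    qed
    then have "norm (?g (s k)) - norm (?g 0) \<le> ?\<phi> (s k) - ?\<phi> 0"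
      using norm_triangle_ineq2 order_trans by blast
    \<comment> \<open>The values at \<open>s k\<close> cancel, so the inequality reduces to its part
      at time 0: \<open>K + m \<le> norm (u k 0) \<le> m\<close>.\<close>
    moreover have "norm (?g (s k)) = ?\<phi> (s k)"
      using k by (simp add: h_def)
    ultimately show ?thesis using m[of k] by simp
  qed
  with le_K[of t i] t show ?thesis by (simp add: h_def)
qed

text \<open>The initial values lie in an interval from 0 to some \<open>D\<close>. Moving its
  midpoint to 0 turns the two-sided norm bound into the lower bound.\<close>

lemma diffuses_nonneg:
  fixes u :: "'n::finite \<Rightarrow> real \<Rightarrow> real"
  assumes u: "diffuses W u e" and W: "\<And>i j. W $ i $ j \<ge> 0"
    and e: "\<And>i t. t \<ge> 0 \<Longrightarrow> \<bar>e i t\<bar> \<le> \<eta>"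
    and D: "\<And>i. u i 0 \<ge> 0"
    and t: "t \<ge> 0"
  shows "u i t \<ge> - (\<eta> * t)"
proof -
  define D where "D = Max (range (\<lambda>i. u i 0))"
  have D': "u i 0 \<le> D" for i by (simp add: D_def)
  have zero: "diffuses W (\<lambda>_ _. 0::real) (\<lambda>_ _. 0)" by (simp add: diffuses_def)
  \<comment> \<open>The factor 1 and the product of zeros only give the term the shape produced by
    \<open>diffuses_affine\<close>.\<close>
  have "norm (1 * u i t + 0 * 0 + (- D / 2)) \<le> D / 2 + \<eta> * t"
  proof (rule diffuses_norm_le[OF diffuses_affine[OF u zero] W _ _ t])
    show "norm (1 * u i 0 + 0 * 0 + (- D / 2)) \<le> D / 2" for i
      using D[of i] D'[of i] by (simp add: abs_if)
  qed (use e in auto)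
  then show ?thesis by (simp add: abs_le_iff)
qed

text \<open>The solution is the matrix exponential of \<open>t B\<close> applied to
  \<open>x0\<close>, taken entrywise as a power series in \<open>t\<close> and dominated by the
  exponential series of \<open>C * \<bar>t\<bar>\<close>.\<close>

lemma linear_ode_exists:
  fixes B :: "real^'k::finite^'k" and x0 :: "real^'k"
  obtains u :: "'k \<Rightarrow> real \<Rightarrow> real" where
    "\<And>i t. (u i has_real_derivative (\<Sum>j\<in>UNIV. B $ i $ j * u j t)) (at t)"
    "\<And>i. u i 0 = x0 $ i"
proof -
  define a where "a n = (((*v) B) ^^ n) x0" for n
  define C where "C = onorm ((*v) B)"
  have C: "norm (B *v y) \<le> C * norm y" for y
    unfolding C_def by (rule onorm) (rule matrix_vector_mul_bounded_linear)
  have C0: "C \<ge> 0" unfolding C_def by (rule onorm_pos_le) (rule matrix_vector_mul_bounded_linear)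
  have a_bound: "norm (a n) \<le> C ^ n * norm x0" for n
  proof (induction n)
    case (Suc n)
    have "norm (a (Suc n)) \<le> C * norm (a n)" using C[of "a n"] by (simp add: a_def)
    also have "\<dots> \<le> C * (C ^ n * norm x0)" using Suc C0 by (intro mult_left_mono)
    finally show ?case by (simp add: mult.assoc)
  qed (simp add: a_def)
  define c where "c i n = a n $ i / fact n" for i n
  have summ: "summable (\<lambda>n. c i n * t ^ n)" for i and t :: real
  proof (rule summable_comparison_test)
    show "summable (\<lambda>n. norm x0 * (inverse (fact n) * (C * \<bar>t\<bar>) ^ n))"
      by (intro summable_mult summable_exp)
    have "norm (c i n * t ^ n) \<le> norm x0 * (inverse (fact n) * (C * \<bar>t\<bar>) ^ n)" for n
    proof -
      have "\<bar>a n $ i\<bar> \<le> C ^ n * norm x0"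
        using a_bound component_le_norm_cart order_trans by blast
      then have "\<bar>a n $ i\<bar> * (inverse (fact n) * \<bar>t\<bar> ^ n) \<le> (C ^ n * norm x0) * (inverse (fact n) * \<bar>t\<bar> ^ n)"
        by (intro mult_right_mono) auto
      then show ?thesis
        by (simp add: c_def abs_mult power_abs power_mult_distrib divide_inverse mult_ac)
    qed
    then show "\<exists>N. \<forall>n\<ge>N. norm (c i n * t ^ n) \<le> norm x0 * (inverse (fact n) * (C * \<bar>t\<bar>) ^ n)"
      by blast
  qed
  define u where "u i t = (\<Sum>n. c i n * t ^ n)" for i and t :: real
  \<comment> \<open>The factor \<open>n + 1\<close> from differentiation cancels in the factorial,
    which leaves one more application of \<open>B\<close>.\<close>
  have diffs_c: "diffs (c i) n * t ^ n = (\<Sum>j\<in>UNIV. B $ i $ j * (c j n * t ^ n))" for i n t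
  proof -
    have "diffs (c i) n = a (Suc n) $ i / fact n"
      by (simp add: diffs_def c_def del: of_nat_Suc)
    then show ?thesis
      by (simp add: a_def c_def matrix_vector_mult_def sum_divide_distrib sum_distrib_left mult_ac)
  qed
  have "(u i has_real_derivative (\<Sum>j\<in>UNIV. B $ i $ j * u j t)) (at t)" for i t
  proof -
    have "(u i has_real_derivative (\<Sum>n. diffs (c i) n * t ^ n)) (at t)"
      unfolding u_def by (rule termdiffs_strong_converges_everywhere[OF summ])
    also have "(\<Sum>n. diffs (c i) n * t ^ n) = (\<Sum>j\<in>UNIV. B $ i $ j * u j t)"
      unfolding diffs_c u_def by (simp add: suminf_sum suminf_mult summ summable_mult)
    finally show ?thesis .
  qed
  moreover have "u i 0 = x0 $ i" for i
    unfolding u_def using suminf_split_head[OF summ[of i 0]] by (simp add: c_def a_def)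
  ultimately show thesis using that by blast
qed

subsection \<open>Convergence to consensus\<close>

text \<open>The integrating factor \<open>exp (c i * s)\<close> removes the loss term, so the
  derivative of \<open>g i\<close> is a nonnegative combination of the entries of \<open>h\<close>.
  Positivity persists at the root and passes along each edge, hence along paths by
  induction.\<close>

lemma diffuses_root_positive:
  fixes h :: "'n::finite \<Rightarrow> real \<Rightarrow> real"
  assumes h: "diffuses W h (\<lambda>_ _. 0)" and W: "\<And>i j. W $ i $ j \<ge> 0"
    and h0: "\<And>i. h i 0 = (if i = r then 1 else 0)"
    and edge: "\<And>i j. (j, i) \<in> E \<Longrightarrow> W $ i $ j > 0"
    and path: "(r, i) \<in> E\<^sup>*" and t: "t > 0"
  shows "h i t > 0"
proof -
  have nonneg: "h j s \<ge> 0" if "s \<ge> 0" for j s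
    using diffuses_nonneg[OF h W, of 0 s j] h0 that by auto
  define c where "c i = (\<Sum>j\<in>UNIV. W $ i $ j)" for i
  define g where "g i s = exp (c i * s) * h i s" for i s
  have g': "(g i has_real_derivative exp (c i * s) * (\<Sum>j\<in>UNIV. W $ i $ j * h j s)) (at s)"
    if "s > 0" for i s
  proof -
    have "(h i has_real_derivative (\<Sum>j\<in>UNIV. W $ i $ j * (h j s - h i s))) (at s)"
      using diffuses_deriv_at[OF h that, of i] by (simp add: has_real_derivative_iff_has_vector_derivative)
    then have "(g i has_real_derivative exp (c i * s) * c i * h i s +
        (\<Sum>j\<in>UNIV. W $ i $ j * (h j s - h i s)) * exp (c i * s)) (at s)"
      unfolding g_def by (auto intro!: derivative_eq_intros)
    moreover have row: "(\<Sum>j\<in>UNIV. W $ i $ j * (h j s - h i s)) =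
        (\<Sum>j\<in>UNIV. W $ i $ j * h j s) - c i * h i s"
      by (simp add: c_def right_diff_distrib sum_subtractf sum_distrib_right)
    have "exp (c i * s) * c i * h i s +
        (\<Sum>j\<in>UNIV. W $ i $ j * (h j s - h i s)) * exp (c i * s) =
        exp (c i * s) * (\<Sum>j\<in>UNIV. W $ i $ j * h j s)"
      unfolding row by (simp add: algebra_simps)
    ultimately show ?thesis by simp
  qed
  have g_cont: "continuous_on {0..s} (g i)" for i s
    unfolding g_def
    by (intro continuous_intros continuous_on_subset[OF diffuses_continuous_on[OF h]]) auto
  have sum_nonneg': "(\<Sum>j\<in>UNIV. W $ i $ j * h j s) \<ge> 0" if "s \<ge> 0" for i s
    using W nonneg[OF that] by (intro sum_nonneg) auto
  show ?thesis using path t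
  proof (induction arbitrary: t rule: rtrancl_induct)
    case base
    have "g r 0 \<le> g r t"
      by (rule DERIV_nonneg_imp_increasing_open[OF _ _ g_cont])
         (use base g' sum_nonneg' in \<open>auto intro!: exI mult_nonneg_nonneg\<close>)
    then have "0 < exp (c r * t) * h r t" by (simp add: g_def h0)
    then show ?case by (simp add: zero_less_mult_iff)
  next
    case (step j i)
    have pos: "(\<Sum>l\<in>UNIV. W $ i $ l * h l s) > 0" if "s > 0" for s
      using edge[OF step.hyps(2)] step.IH[OF that] W nonneg that
      by (intro sum_pos2[of _ j]) auto
    have "g i 0 < g i t"
      by (rule DERIV_pos_imp_increasing_open[OF _ _ g_cont])
         (use step.prems g' pos in \<open>auto intro!: exI mult_pos_pos\<close>)
    moreover have "g i 0 \<ge> 0" by (simp add: g_def nonneg)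
    ultimately have "0 < exp (c i * t) * h i t" by (simp add: g_def)
    then show ?case by (simp add: zero_less_mult_iff)
  qed
qed

text \<open>The flow \<open>h\<close> starting at the indicator of the root \<open>r\<close> is at
  least some \<epsilon> > 0 everywhere at time 1. Comparing \<open>u\<close> with multiples of
  \<open>h\<close> pulls both extremes towards \<open>u r 0\<close> by the fraction \<epsilon>, so
  the spread shrinks by the factor \<open>1 - \<epsilon>\<close>, which is the same for all
  \<open>u\<close>. The forcing costs at most \<open>\<eta>\<close> on each side.\<close>

lemma diffuses_contraction:
  fixes W :: "real^'n::finite^'n"
  assumes W: "\<And>i j. W $ i $ j \<ge> 0"
    and edge: "\<And>i j. (j, i) \<in> E \<Longrightarrow> W $ i $ j > 0"
    and tree: "has_directed_spanning_tree E"
  obtains \<rho> :: real where "0 \<le> \<rho>" "\<rho> < 1"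
    "\<And>u e \<eta> D i j. diffuses W u e \<Longrightarrow> (\<And>i t. t \<ge> 0 \<Longrightarrow> \<bar>e i t :: real\<bar> \<le> \<eta>) \<Longrightarrow>
       (\<And>i j. u i 0 - u j 0 \<le> D) \<Longrightarrow> u i 1 - u j 1 \<le> \<rho> * D + 2 * \<eta>"
proof -
  obtain r where "\<And>j. j \<noteq> r \<Longrightarrow> (r, j) \<in> E\<^sup>+"
    using tree by (auto simp: has_directed_spanning_tree_def)
  then have path: "(r, j) \<in> E\<^sup>*" for j
    by (cases "j = r") (auto intro: trancl_into_rtrancl)
  \<comment> \<open>This is minus the Laplacian of \<open>W\<close>.\<close>
  define B :: "real^'n^'n" where
    "B = (\<chi> i j. W $ i $ j - (if i = j then \<Sum>k\<in>UNIV. W $ i $ k else 0))"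
  obtain h :: "'n \<Rightarrow> real \<Rightarrow> real" where
    h': "\<And>i t. (h i has_real_derivative (\<Sum>j\<in>UNIV. B $ i $ j * h j t)) (at t)" and
    h0: "\<And>i. h i 0 = (axis r 1 :: real^'n) $ i"
    using linear_ode_exists[of B "axis r 1"] by blast
  have B_eq: "(\<Sum>j\<in>UNIV. B $ i $ j * h j t) = (\<Sum>j\<in>UNIV. W $ i $ j *\<^sub>R (h j t - h i t))" for i t
    by (simp add: B_def left_diff_distrib right_diff_distrib sum_subtractf sum_distrib_right
        if_distrib[of "\<lambda>x. x * _"] cong: if_cong)
  have h: "diffuses W h (\<lambda>_ _. 0)"
    unfolding diffuses_def
  proof (intro allI impI)
    fix t :: real and i
    show "(h i has_vector_derivative (\<Sum>j\<in>UNIV. W $ i $ j *\<^sub>R (h j t - h i t)) + 0)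
        (at t within {0..})"
      using h'[of i t] unfolding B_eq
      by (simp add: has_real_derivative_iff_has_vector_derivative has_vector_derivative_at_within)
  qed
  have h0': "h i 0 = (if i = r then 1 else 0)" for i
    by (simp add: h0 axis_def)
  define \<epsilon> where "\<epsilon> = Min (range (\<lambda>i. h i 1))"
  have \<epsilon>_le: "\<epsilon> \<le> h i 1" for i by (simp add: \<epsilon>_def)
  have "\<epsilon> \<in> range (\<lambda>i. h i 1)" unfolding \<epsilon>_def by (intro Min_in) auto
  then have \<epsilon>: "\<epsilon> > 0"
    using diffuses_root_positive[OF h W h0' edge path, where t = 1] by auto
  have "norm (h r 1) \<le> 1 + 0 * 1"
    by (rule diffuses_norm_le[OF h W]) (auto simp: h0')
  with \<epsilon>_le[of r] have \<epsilon>1: "\<epsilon> \<le> 1" by simp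
  show thesis
  proof (rule that[of "1 - \<epsilon>"])
    fix u e \<eta> D and i j :: 'n
    assume u: "diffuses W u e" and e: "\<And>i t. t \<ge> 0 \<Longrightarrow> \<bar>e i t :: real\<bar> \<le> \<eta>"
      and D: "\<And>i j. u i 0 - u j 0 \<le> D"
    define a where "a = Min (range (\<lambda>i. u i 0))"
    define b where "b = Max (range (\<lambda>i. u i 0))"
    have ab: "a \<le> u k 0" "u k 0 \<le> b" for k by (simp_all add: a_def b_def)
    have "a \<in> range (\<lambda>i. u i 0)" "b \<in> range (\<lambda>i. u i 0)"
      unfolding a_def b_def by (intro Min_in Max_in; simp)+
    then have "b - a \<le> D" using D by auto
    \<comment> \<open>This flow starts at 0 in the entry \<open>r\<close> and at nonnegative values
      elsewhere. The next inequality is its mirror image at the maximum \<open>b\<close>.\<close>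
    have "1 * u j 1 + (- (u r 0 - a)) * h j 1 + (- a) \<ge> - (\<eta> * 1)"
      by (rule diffuses_nonneg[OF diffuses_affine[OF u h] W])
         (use e ab in \<open>auto simp: h0'\<close>)
    moreover have "(- 1) * u i 1 + (- (b - u r 0)) * h i 1 + b \<ge> - (\<eta> * 1)"
      by (rule diffuses_nonneg[OF diffuses_affine[OF u h] W])
         (use e ab in \<open>auto simp: h0'\<close>)
    moreover have "(u r 0 - a) * \<epsilon> \<le> (u r 0 - a) * h j 1" "(b - u r 0) * \<epsilon> \<le> (b - u r 0) * h i 1"
      using ab \<epsilon>_le by (auto intro!: mult_left_mono)
    ultimately have "u i 1 - u j 1 \<le> (b - a) - ((u r 0 - a) * \<epsilon> + (b - u r 0) * \<epsilon>) + 2 * \<eta>"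
      by (simp add: algebra_simps)
    also have "\<dots> = (1 - \<epsilon>) * (b - a) + 2 * \<eta>" by algebra
    also have "\<dots> \<le> (1 - \<epsilon>) * D + 2 * \<eta>"
      using \<open>b - a \<le> D\<close> \<epsilon>1 by (simp add: mult_left_mono)
    finally show "u i 1 - u j 1 \<le> (1 - \<epsilon>) * D + 2 * \<eta>" .
  qed (use \<epsilon> \<epsilon>1 in auto)
qed

text \<open>Continuity gives a common bound \<open>K\<close> on one unit interval of starting points
  \<open>s\<close>. Iterating the step from there reaches all later times as
  \<open>s + n\<close>.\<close>

lemma contracting_tendsto_zero:
  fixes f :: "real \<Rightarrow> real"
  assumes cont: "continuous_on {0..} f" and nonneg: "\<And>t. t \<ge> 0 \<Longrightarrow> f t \<ge> 0"
    and \<rho>: "0 \<le> \<rho>" "\<rho> < 1"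
    and step: "\<And>\<epsilon>. \<epsilon> > 0 \<Longrightarrow> \<exists>T\<ge>0. \<forall>t\<ge>T. f (t + 1) \<le> \<rho> * f t + \<epsilon>"
  shows "(f \<longlongrightarrow> 0) at_top"
proof (rule tendstoI)
  fix \<epsilon> :: real assume \<epsilon>: "\<epsilon> > 0"
  define \<delta> where "\<delta> = \<epsilon> / 3"
  have \<delta>: "\<delta> > 0" using \<epsilon> by (simp add: \<delta>_def)
  \<comment> \<open>The slack \<open>(1 - \<rho>) * \<delta>\<close> makes \<open>\<delta>\<close>
    the fixed point of the affine recursion, so the errors never add up beyond
    \<open>\<delta>\<close>.\<close>
  then obtain T where T: "T \<ge> 0" "\<And>t. t \<ge> T \<Longrightarrow> f (t + 1) \<le> \<rho> * f t + (1 - \<rho>) * \<delta>"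
    using step[of "(1 - \<rho>) * \<delta>"] \<rho> by auto
  have "\<exists>s\<in>{T..T+1}. \<forall>r\<in>{T..T+1}. f r \<le> f s"
    by (intro continuous_attains_sup continuous_on_subset[OF cont]) (use T in auto)
  then obtain K where K: "\<And>r. r \<in> {T..T+1} \<Longrightarrow> f r \<le> K" by metis
  have K0: "K \<ge> 0" using K[of T] nonneg[of T] T by auto
  have iter: "f (s + real n) \<le> \<rho> ^ n * K + \<delta>" if s: "s \<in> {T..T+1}" for s n
  proof (induction n)
    case 0
    then show ?case using K[OF s] \<delta> by simp
  next
    case (Suc n)
    have "f (s + real (Suc n)) \<le> \<rho> * f (s + real n) + (1 - \<rho>) * \<delta>"
      using T(2)[of "s + real n"] s by (simp add: algebra_simps)
    also have "\<dots> \<le> \<rho> * (\<rho> ^ n * K + \<delta>) + (1 - \<rho>) * \<delta>"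
      using Suc \<rho> by (intro add_right_mono mult_left_mono)
    finally show ?case by (simp add: algebra_simps)
  qed
  have "(\<lambda>n. \<rho> ^ n * K) \<longlonglongrightarrow> 0"
    using \<rho> by (intro tendsto_mult_left_zero LIMSEQ_power_zero) auto
  from order_tendstoD(2)[OF this \<delta>] obtain N where N: "\<And>n. n \<ge> N \<Longrightarrow> \<rho> ^ n * K < \<delta>"
    by (auto simp: eventually_sequentially)
  have "dist (f t) 0 < \<epsilon>" if t: "t \<ge> T + real N" for t
  proof -
    \<comment> \<open>With this \<open>n\<close>, the starting point \<open>t - n\<close> lies
      between \<open>T\<close> and \<open>T + 1\<close>.\<close>
    define n where "n = nat \<lfloor>t - T\<rfloor>"
    have n: "real n \<le> t - T" "t - T < real n + 1" "n \<ge> N"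
      using t by (auto simp: n_def le_nat_floor)
    have "f t \<le> \<rho> ^ n * K + \<delta>" using iter[of "t - real n" n] n by simp
    then show ?thesis using N[OF n(3)] nonneg[of t] t T \<delta> by (simp add: \<delta>_def)
  qed
  then show "\<forall>\<^sub>F t in at_top. dist (f t) 0 < \<epsilon>"
    unfolding eventually_at_top_linorder by blast
qed

text \<open>Restarted at a late time, the flow sees only small forcing during the next unit of time,
  so its spread \<open>f\<close> satisfies the hypothesis of
  \<open>contracting_tendsto_zero\<close>.\<close>

lemma diffuses_consensus:
  fixes u :: "'n::finite \<Rightarrow> real \<Rightarrow> real"
  assumes u: "diffuses W u e" and W: "\<And>i j. W $ i $ j \<ge> 0"
    and edge: "\<And>i j. (j, i) \<in> E \<Longrightarrow> W $ i $ j > 0"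
    and tree: "has_directed_spanning_tree E"
    and e: "\<And>i. (e i \<longlongrightarrow> 0) at_top"
  shows "((\<lambda>t. u i t - u j t) \<longlongrightarrow> 0) at_top"
proof -
  obtain \<rho> where \<rho>: "0 \<le> \<rho>" "\<rho> < 1" and contr:
    "\<And>u e \<eta> D i j. diffuses W u e \<Longrightarrow> (\<And>i t. t \<ge> 0 \<Longrightarrow> \<bar>e i t :: real\<bar> \<le> \<eta>) \<Longrightarrow>
       (\<And>i j. u i 0 - u j 0 \<le> D) \<Longrightarrow> u i 1 - u j 1 \<le> \<rho> * D + 2 * \<eta>"
    using diffuses_contraction[OF W edge tree] by blast
  \<comment> \<open>Indexing a vector by pairs of vertices makes the largest difference of entries a
    norm, so its continuity follows from that of the entries.\<close>
  define f where "f t = infnorm (\<chi> k. u (fst k) t - u (snd k) t)" for t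
  have f_ge: "\<bar>u i t - u j t\<bar> \<le> f t" for i j t
    using component_le_infnorm_cart[of "\<chi> k. u (fst k) t - u (snd k) t" "(i, j)"] by (simp add: f_def)
  have f_le: "f t \<le> D" if "\<And>i j. u i t - u j t \<le> D" for t D
  proof -
    have "\<bar>u i t - u j t\<bar> \<le> D" for i j using that[of i j] that[of j i] by (simp add: abs_le_iff)
    then show ?thesis
      unfolding f_def by (auto simp: vec_norm_inf_eq_infnorm[symmetric] vec_norm_inf_def)
  qed
  have "(f \<longlongrightarrow> 0) at_top"
  proof (rule contracting_tendsto_zero[OF _ _ \<rho>])
    show "continuous_on {0..} f"
      unfolding f_def
      by (intro continuous_on_infnorm continuous_on_vec_lambda continuous_intros
          diffuses_continuous_on[OF u])
    show "f t \<ge> 0" for t by (simp add: f_def infnorm_pos_le)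
    fix \<epsilon> :: real assume "\<epsilon> > 0"
    \<comment> \<open>Half of \<epsilon> is needed because the contraction estimate doubles the
      forcing bound.\<close>
    then have "\<forall>\<^sub>F t in at_top. \<bar>e i t\<bar> < \<epsilon> / 2" for i
      using tendstoD[OF e[of i], of "\<epsilon> / 2"] by simp
    then have "\<forall>\<^sub>F t in at_top. \<forall>i. \<bar>e i t\<bar> < \<epsilon> / 2"
      by (intro eventually_all_finite)
    then obtain T where T: "\<And>t i. t \<ge> T \<Longrightarrow> \<bar>e i t\<bar> < \<epsilon> / 2"
      by (auto simp: eventually_at_top_linorder)
    have "f (t + 1) \<le> \<rho> * f t + \<epsilon>" if t: "t \<ge> max 0 T" for t
    proof (rule f_le)
      fix i j
      have "u i (t + 1) - u j (t + 1) \<le> \<rho> * f t + 2 * (\<epsilon> / 2)"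
      proof (rule contr[OF diffuses_shift[OF u, of t]])
        show "u i (t + 0) - u j (t + 0) \<le> f t" for i j
          using f_ge[of i t j] by simp
      qed (use t T in \<open>auto intro!: less_imp_le\<close>)
      then show "u i (t + 1) - u j (t + 1) \<le> \<rho> * f t + \<epsilon>" by simp
    qed
    then show "\<exists>T\<ge>0. \<forall>t\<ge>T. f (t + 1) \<le> \<rho> * f t + \<epsilon>"
      by (intro exI[of _ "max 0 T"]) auto
  qed
  then show ?thesis
    by (rule Lim_null_comparison[rotated]) (simp add: f_ge)
qed

subsection \<open>Laplacians and the serial system\<close>

lemma laplacian_nth:
  "(graph_laplacian W *v q) $ i = (\<Sum>j\<in>UNIV. W $ i $ j * (q $ i - q $ j))"
  for q :: "real^'n::finite"
proof -
  have "(diag_matrix (W *v 1) *v q) $ i = (\<Sum>j\<in>UNIV. W $ i $ j) * q $ i"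
    by (simp add: diag_matrix_def matrix_vector_mult_def if_distrib[of "\<lambda>x. x * _"] cong: if_cong)
  then show ?thesis
    unfolding graph_laplacian_def matrix_vector_mult_diff_rdistrib
    by (simp add: matrix_vector_mult_def right_diff_distrib sum_subtractf sum_distrib_right)
qed

lemma diffuses_laplacian:
  fixes f :: "real \<Rightarrow> real^'n::finite"
  assumes f: "\<And>t. t \<ge> 0 \<Longrightarrow>
    (f has_vector_derivative - (p *\<^sub>R (graph_laplacian W *v f t)) + g t) (at t within {0..})"
  shows "diffuses (p *\<^sub>R W) (\<lambda>i t. f t $ i) (\<lambda>i t. g t $ i)"
  unfolding diffuses_def
proof (intro allI impI)
  fix t :: real and i :: 'n assume "t \<ge> 0"
  from bounded_linear.has_vector_derivative[OF bounded_linear_vec_nth f[OF this], of i]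
  show "((\<lambda>t. f t $ i) has_vector_derivative
      (\<Sum>j\<in>UNIV. (p *\<^sub>R W) $ i $ j *\<^sub>R (f t $ j - f t $ i)) + g t $ i) (at t within {0..})"
    by (simp add: laplacian_nth sum_distrib_left sum_subtractf algebra_simps)
qed

lemma laplacian_tendsto_zero:
  fixes f :: "real \<Rightarrow> real^'n::finite"
  assumes "\<And>i j. ((\<lambda>t. f t $ i - f t $ j) \<longlongrightarrow> 0) F"
  shows "((\<lambda>t. graph_laplacian W *v f t) \<longlongrightarrow> 0) F"
proof (rule vec_tendstoI)
  fix i
  show "((\<lambda>t. (graph_laplacian W *v f t) $ i) \<longlongrightarrow> 0 $ i) F"
    unfolding laplacian_nth using assms
    by (auto intro!: tendsto_null_sum tendsto_mult_right_zero)
qed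

text \<open>\<open>L q\<close> is nonnegative where \<open>q\<close> is maximal and nonpositive where \<open>q\<close> is
  minimal, so every entry of \<open>L q\<close> is bounded by a difference of two entries.\<close>

lemma laplacian_image_bound:
  fixes q :: "real^'n::finite"
  assumes W: "\<And>i j. W $ i $ j \<ge> 0" and y: "y = graph_laplacian W *v q"
  shows "\<bar>y $ k\<bar> \<le> (\<Sum>i\<in>UNIV. \<Sum>j\<in>UNIV. \<bar>y $ i - y $ j\<bar>)"
proof -
  have "Max (range (($) q)) \<in> range (($) q)" "Min (range (($) q)) \<in> range (($) q)"
    by (intro Max_in Min_in; simp)+
  then obtain a b where "q $ a = Max (range (($) q))" "q $ b = Min (range (($) q))"
    by (metis imageE)
  then have "\<And>j. q $ j \<le> q $ a" "\<And>j. q $ b \<le> q $ j" by simp_all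
  then have ya: "y $ a \<ge> 0" and yb: "y $ b \<le> 0"
    unfolding y laplacian_nth using W
    by (auto intro!: sum_nonneg sum_nonpos mult_nonneg_nonpos)
  have le: "\<bar>y $ i - y $ j\<bar> \<le> (\<Sum>i\<in>UNIV. \<Sum>j\<in>UNIV. \<bar>y $ i - y $ j\<bar>)" for i j
    by (rule order_trans[OF member_le_sum[of j UNIV "\<lambda>j. \<bar>y $ i - y $ j\<bar>"]
          member_le_sum[of i UNIV "\<lambda>i. \<Sum>j\<in>UNIV. \<bar>y $ i - y $ j\<bar>"]]) (auto intro: sum_nonneg)
  show ?thesis using le[of a k] le[of k b] ya yb by linarith
qed

lemma laplacian_image_tendsto_zero:
  fixes y :: "real \<Rightarrow> real^'n::finite"
  assumes W: "\<And>i j. W $ i $ j \<ge> 0" and y: "\<And>t. y t = graph_laplacian W *v q t"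
    and lim: "\<And>i j. ((\<lambda>t. y t $ i - y t $ j) \<longlongrightarrow> 0) F"
  shows "(y \<longlongrightarrow> 0) F"
proof (rule vec_tendstoI)
  fix k
  have "((\<lambda>t. \<Sum>i\<in>UNIV. \<Sum>j\<in>UNIV. \<bar>y t $ i - y t $ j\<bar>) \<longlongrightarrow> 0) F"
    using lim by (intro tendsto_null_sum tendsto_rabs_zero)
  then show "((\<lambda>t. y t $ k) \<longlongrightarrow> 0 $ k) F"
    unfolding zero_index
    by (rule Lim_null_comparison[rotated]) (simp add: laplacian_image_bound[OF W y])
qed

section \<open>Maximum norms and inverse matrices\<close>

lemma norm_nth_le_vec_norm_inf: "norm (x $ i) \<le> vec_norm_inf x"
  by (simp add: vec_norm_inf_def)

lemma vec_norm_inf_le: "(\<And>i. norm (x $ i) \<le> b) \<Longrightarrow> vec_norm_inf x \<le> b"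
  by (simp add: vec_norm_inf_def)

lemma vec_norm_inf_nonneg: "vec_norm_inf x \<ge> 0"
  using norm_nth_le_vec_norm_inf[of x undefined] norm_ge_zero order_trans by blast

lemma norm_matrix_vector_mult_nth_le:
  fixes C :: "'a::real_normed_algebra_1^'n::finite^'m::finite"
  assumes "\<And>j. norm (x $ j) \<le> b"
  shows "norm ((C *v x) $ i) \<le> mat_norm_inf C * b"
proof -
  have b: "b \<ge> 0" using assms[of undefined] norm_ge_zero order_trans by blast
  have "norm ((C *v x) $ i) \<le> (\<Sum>j\<in>UNIV. norm (C $ i $ j) * b)"
    unfolding matrix_vector_mult_def
    by (auto intro!: sum_norm_le order_trans[OF norm_mult_ineq] mult_left_mono assms)
  also have "\<dots> = (\<Sum>j\<in>UNIV. norm (C $ i $ j)) * b" by (simp add: sum_distrib_right)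
  also have "\<dots> \<le> mat_norm_inf C * b"
    using b by (intro mult_right_mono) (simp_all add: mat_norm_inf_def)
  finally show ?thesis .
qed

lemma
  fixes S :: "'a::field^'n::finite^'n"
  assumes "invertible S"
  shows matrix_inv_right_mult: "S ** matrix_inv S = mat 1"
    and matrix_inv_left_mult: "matrix_inv S ** S = mat 1"
  using someI_ex[OF assms[unfolded invertible_def]] by (simp_all add: matrix_inv_def)

section \<open>Spectral decoupling of the serial system\<close>

text \<open>The characteristic polynomial of the companion matrix is
  \<open>(\<lambda> + p1) (\<lambda> + p2) (\<lambda> + p3)\<close>.\<close>

lemma companion3_left_eigenvector:
  fixes S :: "'a::real_normed_field^3^3"
  assumes A: "A = companion3 (p1 * p2 * p3) (p1 * p2 + p1 * p3 + p2 * p3) (p1 + p2 + p3)"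
    and diag: "diagonalizes S (map_matrix of_real A)"
  obtains p where "p \<in> {p1, p2, p3}"
    "\<And>l. (\<Sum>m\<in>UNIV. matrix_inv S $ k $ m * of_real (A $ m $ l)) = - of_real p * matrix_inv S $ k $ l"
proof -
  let ?R = "matrix_inv S" and ?A = "map_matrix of_real A :: 'a^3^3"
  have inv: "invertible S" using diag by (simp add: diagonalizes_def)
  define M where "M = ?R ** ?A ** S"
  define c where "c = M $ k $ k"
  \<comment> \<open>As \<open>M\<close> is diagonal, each row of \<open>?R\<close> is a left
    eigenvector of \<open>?A\<close>.\<close>
  have M: "?R ** ?A = M ** ?R"
    unfolding M_def by (simp add: matrix_mul_assoc[symmetric] matrix_inv_right_mult[OF inv])
  have "(?R ** ?A) $ k $ l = (\<Sum>m\<in>UNIV. M $ k $ m * ?R $ m $ l)" for l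
    unfolding M by (simp add: matrix_matrix_mult_def)
  also have "(\<Sum>m\<in>UNIV. M $ k $ m * ?R $ m $ l) =
      (\<Sum>m\<in>UNIV. if m = k then c * ?R $ k $ l else 0)" for l
    using diag by (intro sum.cong) (auto simp: diagonalizes_def c_def M_def)
  finally have row: "(\<Sum>m\<in>UNIV. ?R $ k $ m * ?A $ m $ l) = c * ?R $ k $ l" for l
    by (simp add: matrix_matrix_mult_def)
  have eqs: "- (of_real (p1 * p2 * p3) * ?R $ k $ 3) = c * ?R $ k $ 1"
    "?R $ k $ 1 - of_real (p1 * p2 + p1 * p3 + p2 * p3) * ?R $ k $ 3 = c * ?R $ k $ 2"
    "?R $ k $ 2 - of_real (p1 + p2 + p3) * ?R $ k $ 3 = c * ?R $ k $ 3"
    using row[of 1] row[of 2] row[of 3] by (simp_all add: sum_3 A companion3_def algebra_simps)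
  \<comment> \<open>The last entry determines the other two through \<open>eqs\<close>, so its
    vanishing would make a whole row of the inverse zero.\<close>
  have "?R $ k $ 3 \<noteq> 0"
  proof
    assume "?R $ k $ 3 = 0"
    with eqs have "?R $ k $ m = 0" for m using exhaust_3[of m] by auto
    then have "(?R ** S) $ k $ k = 0" by (simp add: matrix_matrix_mult_def)
    then show False by (simp add: matrix_inv_left_mult[OF inv] mat_def)
  qed
  \<comment> \<open>Eliminating the first two entries from \<open>eqs\<close> leaves the
    characteristic polynomial at \<open>c\<close> times the last entry.\<close>
  moreover have "?R $ k $ 3 * ((c + of_real p1) * (c + of_real p2) * (c + of_real p3)) = 0"
    using eqs unfolding of_real_mult of_real_add by algebra
  ultimately obtain p where p: "p \<in> {p1, p2, p3}" "c = - of_real p"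
    by (auto simp: eq_neg_iff_add_eq_0)
  show thesis
  proof (rule that[OF p(1)])
    show "(\<Sum>m\<in>UNIV. ?R $ k $ m * of_real (A $ m $ l)) = - of_real p * ?R $ k $ l" for l
      using row[of l] p(2) by simp
  qed
qed

text \<open>This is the homogeneous linear system whose matrix is the Kronecker product of
  \<open>A\<close> and \<open>L\<close>, with \<open>j\<close> numbering the blocks and
  \<open>i\<close> the vertices.\<close>

definition serial_flow ::
  "real^'k::finite^'k \<Rightarrow> real^'n^'n \<Rightarrow> ('k \<Rightarrow> real \<Rightarrow> real^'n::finite) \<Rightarrow> bool" where
  "serial_flow A L c \<longleftrightarrow> (\<forall>t\<ge>0. \<forall>j i. ((\<lambda>t. c j t $ i) has_real_derivative
     (\<Sum>k\<in>UNIV. A $ j $ k * (L *v c k t) $ i)) (at t within {0..}))"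

lemma serial_flow_exists:
  fixes A :: "real^'k::finite^'k" and L :: "real^'n::finite^'n"
  obtains c where "serial_flow A L c" "\<And>j. c j 0 = c0 j"
proof -
  define B :: "real^('k \<times> 'n)^('k \<times> 'n)" where
    "B = (\<chi> a b. A $ fst a $ fst b * L $ snd a $ snd b)"
  obtain u where u: "\<And>a t. (u a has_real_derivative (\<Sum>b\<in>UNIV. B $ a $ b * u b t)) (at t)"
    "\<And>a. u a 0 = (\<chi> a. c0 (fst a) $ snd a) $ a"
    using linear_ode_exists[of B "\<chi> a. c0 (fst a) $ snd a"] by blast
  define c where "c j t = (\<chi> i. u (j, i) t)" for j t
  have "(\<Sum>b\<in>UNIV. B $ (j, i) $ b * u b t) = (\<Sum>k\<in>UNIV. A $ j $ k * (L *v c k t) $ i)" for j i t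
    by (simp add: B_def c_def matrix_vector_mult_def sum_distrib_left mult.assoc
        sum.cartesian_product case_prod_beta UNIV_Times_UNIV[symmetric] del: UNIV_Times_UNIV)
  then have "serial_flow A L c"
    using u(1) by (auto simp: serial_flow_def c_def intro: has_field_derivative_at_within)
  moreover have "c j 0 = c0 j" for j by (simp add: c_def u(2) vec_eq_iff)
  ultimately show thesis using that by blast
qed

lemma serial_flow_add:
  assumes "serial_flow A L c" "serial_flow A L c'"
  shows "serial_flow A L (\<lambda>j t. c j t + c' j t)"
  using assms unfolding serial_flow_def
  by (auto simp: matrix_vector_right_distrib algebra_simps sum.distrib intro!: derivative_intros)

text \<open>In eigencoordinates the system splits into unforced consensus flows, which preserve the
  bound \<open>m\<close>. The bound is placed on the initial eigencoordinates themselves, so that it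
  can be estimated by a full matrix norm for \<open>S2\<close> but by a single column of the inverse
  for \<open>S1\<close>.\<close>

lemma serial_flow_bound:
  fixes S :: "'a::real_normed_field^3^3" and c :: "3 \<Rightarrow> real \<Rightarrow> real^'n::finite"
  assumes A: "A = companion3 (p1 * p2 * p3) (p1 * p2 + p1 * p3 + p2 * p3) (p1 + p2 + p3)"
    and flow: "serial_flow A (graph_laplacian W) c"
    and diag: "diagonalizes S (map_matrix of_real A)"
    and W: "\<And>i j. W $ i $ j \<ge> 0" and pos: "p1 > 0" "p2 > 0" "p3 > 0"
    and m: "\<And>i k. norm ((matrix_inv S *v (\<chi> j. of_real (c j 0 $ i))) $ k) \<le> m"
    and t: "t \<ge> 0"
  shows "\<bar>c j t $ i\<bar> \<le> mat_norm_inf S * m"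
proof -
  let ?R = "matrix_inv S" and ?L = "graph_laplacian W"
  have inv: "invertible S" using diag by (simp add: diagonalizes_def)
  \<comment> \<open>The eigencoordinates of the triple at vertex \<open>i\<close>. For fixed
    \<open>k\<close>, the \<open>k\<close>-th coordinates over all vertices form a consensus flow
    with weights \<open>p *\<^sub>R W\<close>.\<close>
  define q where "q i t = ?R *v (\<chi> j. (of_real (c j t $ i) :: 'a))" for i t
  have "norm (q i t $ k) \<le> m" for i k
  proof -
    obtain p where p: "p \<in> {p1, p2, p3}" and row:
      "\<And>l. (\<Sum>m\<in>UNIV. ?R $ k $ m * of_real (A $ m $ l)) = - of_real p * ?R $ k $ l"
      using companion3_left_eigenvector[OF A diag] by blast
    have "diffuses (p *\<^sub>R W) (\<lambda>i t. q i t $ k) (\<lambda>_ _. 0)"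
      unfolding diffuses_def
    proof (intro allI impI)
      fix s :: real and i :: 'n assume s: "s \<ge> 0"
      have "((\<lambda>t. q i t $ k) has_vector_derivative
          (\<Sum>j\<in>UNIV. ?R $ k $ j * of_real (\<Sum>l\<in>UNIV. A $ j $ l * (?L *v c l s) $ i)))
          (at s within {0..})"
        unfolding q_def matrix_vector_mult_def vec_lambda_beta
        using flow s unfolding serial_flow_def
        by (intro has_vector_derivative_sum has_vector_derivative_mult_right
            has_vector_derivative_of_real) (auto simp: matrix_vector_mult_def)
      also have "(\<Sum>j\<in>UNIV. ?R $ k $ j * of_real (\<Sum>l\<in>UNIV. A $ j $ l * (?L *v c l s) $ i)) =
          (\<Sum>l\<in>UNIV. (\<Sum>j\<in>UNIV. ?R $ k $ j * of_real (A $ j $ l)) * of_real ((?L *v c l s) $ i))"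
        by (simp add: sum_distrib_left sum_distrib_right mult.assoc) (rule sum.swap)
      also have "\<dots> = (\<Sum>l\<in>UNIV. - of_real p * ?R $ k $ l * of_real ((?L *v c l s) $ i))"
        by (simp only: row)
      also have "\<dots> = (\<Sum>l\<in>UNIV. \<Sum>j\<in>UNIV. - of_real p * ?R $ k $ l * of_real (W $ i $ j * (c l s $ i - c l s $ j)))"
        by (simp add: laplacian_nth sum_distrib_left)
      also have "\<dots> = (\<Sum>j\<in>UNIV. \<Sum>l\<in>UNIV. - of_real p * ?R $ k $ l * of_real (W $ i $ j * (c l s $ i - c l s $ j)))"
        by (rule sum.swap)
      also have "\<dots> = (\<Sum>j\<in>UNIV. (p *\<^sub>R W) $ i $ j *\<^sub>R (q j s $ k - q i s $ k)) + 0"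
        unfolding vector_scaleR_component
        by (simp add: q_def matrix_vector_mult_def scaleR_conv_of_real sum_subtractf[symmetric]
            sum_distrib_left algebra_simps)
      finally show "((\<lambda>t. q i t $ k) has_vector_derivative
          (\<Sum>j\<in>UNIV. (p *\<^sub>R W) $ i $ j *\<^sub>R (q j s $ k - q i s $ k)) + 0) (at s within {0..})" .
    qed
    from diffuses_norm_le[OF this, of 0 m t i] show ?thesis
      using m W p pos t by (auto simp: q_def)
  qed
  then have "norm ((S *v q i t) $ j) \<le> mat_norm_inf S * m"
    by (rule norm_matrix_vector_mult_nth_le)
  moreover have "S *v q i t = (\<chi> j. of_real (c j t $ i))"
    by (simp add: q_def matrix_vector_mul_assoc matrix_inv_right_mult[OF inv])
  ultimately show ?thesis by simp
qed

text \<open>The supremum is taken in \<open>ereal\<close>, so the estimate includes the boundedness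
  of the state. \<open>S1\<close> and \<open>S2\<close> may have entries in two different normed
  fields, which covers real and complex diagonalizing matrices.\<close>

theorem theorem3:
  fixes E :: "('n::finite \<times> 'n) set" and W L :: "real^'n^'n"
    and p1 p2 p3 av ap aI :: real
    and d w0 :: "real^'n" and w x v z :: "real \<Rightarrow> real^'n"
    and \<xi> :: "real \<Rightarrow> real^('n + 'n + 'n)"
  assumes adjacency: "is_weighted_adjacency E W"
    and tree: "has_directed_spanning_tree E"
    and L: "L = graph_laplacian W"
    and pos: "p1 > 0" "p2 > 0" "p3 > 0"
    and av: "av = p1 + p2 + p3"
    and ap: "ap = p1 * p2 + p1 * p3 + p2 * p3"
    and aI: "aI = p1 * p2 * p3"
    and w: "\<And>t. t \<ge> 0 \<Longrightarrow> w t = L *v w0"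
    and system: "third_order_serial_consensus L aI ap av d w x v z"
    and \<xi>: "\<xi> = consensus_state L d x v z"
  shows "((\<lambda>t. L *v (x t - d)) \<longlongrightarrow> 0) at_top \<and>
    ((\<lambda>t. L *v v t) \<longlongrightarrow> 0) at_top \<and>
    (\<forall>(S1 :: ('a::real_normed_field)^3^3) (S2 :: ('b::real_normed_field)^3^3).
       diagonalizes S1 (map_matrix of_real (companion3 aI ap av)) \<longrightarrow>
       diagonalizes S2 (map_matrix of_real (companion3 aI ap av)) \<longrightarrow>
       (SUP t\<in>{0..}. ereal (vec_norm_inf (\<xi> t))) \<le>
         ereal (mat_norm_inf S2 * mat_norm_inf (matrix_inv S2) * vec_norm_inf (\<xi> 0) +
                2 / (p1 * p2 * p3) * mat_norm_inf S1 *
                  vec_norm_inf (matrix_inv S1 *v vector [1, 0, 0]) * vec_norm_inf w0))"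
proof (intro conjI allI impI)
  have W: "W $ i $ j \<ge> 0" and edge: "(j, i) \<in> E \<Longrightarrow> W $ i $ j > 0" for i j
    using adjacency by (auto simp: is_weighted_adjacency_def)
  have aI0: "aI > 0" using pos aI by simp
  define zs where "zs t = z t - (1 / aI) *\<^sub>R w0" for t
  define y where "y t = L *v (x t - d)" for t
  have sys: "(z has_vector_derivative (L ** L) *v (x t - d)) (at t within {0..})"
    "(x has_vector_derivative v t) (at t within {0..})"
    "(v has_vector_derivative
       - (av *\<^sub>R (L *v v t)) - ap *\<^sub>R ((L ** L) *v (x t - d)) - aI *\<^sub>R (L *v z t) + w t)
      (at t within {0..})" if "t \<ge> 0" for t
    using system that by (auto simp: third_order_serial_consensus_def)
  have zs': "(zs has_vector_derivative L *v y t) (at t within {0..})" if "t \<ge> 0" for t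
    unfolding zs_def y_def matrix_vector_mul_assoc
    by (auto intro!: derivative_eq_intros sys(1)[OF that])
  have y': "(y has_vector_derivative L *v v t) (at t within {0..})" if "t \<ge> 0" for t
    unfolding y_def
    by (rule bounded_linear.has_vector_derivative[OF matrix_vector_mul_bounded_linear])
       (auto intro!: derivative_eq_intros sys(2)[OF that])
  have v': "(v has_vector_derivative
      - (aI *\<^sub>R (L *v zs t)) - ap *\<^sub>R (L *v y t) - av *\<^sub>R (L *v v t)) (at t within {0..})"
    if "t \<ge> 0" for t
    using sys(3)[OF that] aI0
    by (simp add: w[OF that] y_def zs_def matrix_vector_mul_assoc matrix_vector_mult_diff_distrib
        matrix_vector_mult_scaleR algebra_simps)

  \<comment> \<open>Cascade of consensus flows and convergence\<close>
  define a where "a t = v t + (p1 + p2) *\<^sub>R y t + (p1 * p2) *\<^sub>R zs t" for t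
  define b where "b t = y t + p1 *\<^sub>R zs t" for t
  have a': "(a has_vector_derivative - (p3 *\<^sub>R (L *v a t)) + 0) (at t within {0..})" if "t \<ge> 0" for t
    unfolding a_def
    by (rule derivative_eq_intros v' y' zs' that refl)+
       (simp add: av ap aI matrix_vector_right_distrib matrix_vector_mult_scaleR algebra_simps)
  have b': "(b has_vector_derivative - (p2 *\<^sub>R (L *v b t)) + L *v a t) (at t within {0..})"
    if "t \<ge> 0" for t
    unfolding b_def a_def
    by (rule derivative_eq_intros y' zs' that refl)+
       (simp add: matrix_vector_right_distrib matrix_vector_mult_scaleR algebra_simps)
  have zs'': "(zs has_vector_derivative - (p1 *\<^sub>R (L *v zs t)) + L *v b t) (at t within {0..})"
    if "t \<ge> 0" for t
    using zs'[OF that] by (simp add: b_def matrix_vector_right_distrib matrix_vector_mult_scaleR)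
  have consensus: "((\<lambda>t. f t $ i - f t $ j) \<longlongrightarrow> 0) at_top"
    if "p > 0" "\<And>t. t \<ge> 0 \<Longrightarrow> (f has_vector_derivative - (p *\<^sub>R (L *v f t)) + g t) (at t within {0..})"
      "(g \<longlongrightarrow> 0) at_top" for p f g i j
    using that W edge tree
    by (intro diffuses_consensus[OF diffuses_laplacian[of f p W g]])
       (auto simp: L intro: tendsto_vec_nth[of g 0, simplified])
  have a_cons: "((\<lambda>t. a t $ i - a t $ j) \<longlongrightarrow> 0) at_top" for i j
    by (rule consensus[OF pos(3) a']) auto
  have b_cons: "((\<lambda>t. b t $ i - b t $ j) \<longlongrightarrow> 0) at_top" for i j
    by (rule consensus[OF pos(2) b']) (auto simp: L intro: laplacian_tendsto_zero a_cons)
  have zs_cons: "((\<lambda>t. zs t $ i - zs t $ j) \<longlongrightarrow> 0) at_top" for i j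
    by (rule consensus[OF pos(1) zs'']) (auto simp: L intro: laplacian_tendsto_zero b_cons)
  have y_cons: "((\<lambda>t. y t $ i - y t $ j) \<longlongrightarrow> 0) at_top" for i j
    using tendsto_diff[OF b_cons[of i j] tendsto_mult_right_zero[OF zs_cons[of i j], of p1]]
    by (simp add: b_def algebra_simps)
  have v_cons: "((\<lambda>t. v t $ i - v t $ j) \<longlongrightarrow> 0) at_top" for i j
    using tendsto_diff[OF tendsto_diff[OF a_cons[of i j]
          tendsto_mult_right_zero[OF y_cons[of i j], of "p1 + p2"]]
          tendsto_mult_right_zero[OF zs_cons[of i j], of "p1 * p2"]]
    by (simp add: a_def algebra_simps)
  \<comment> \<open>Consensus alone would allow a nonzero common value. It is excluded because
    \<open>y\<close> lies in the range of the Laplacian.\<close>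
  have "(y \<longlongrightarrow> 0) at_top"
    by (rule laplacian_image_tendsto_zero[OF W _ y_cons]) (simp add: y_def L)
  then show "((\<lambda>t. L *v (x t - d)) \<longlongrightarrow> 0) at_top" unfolding y_def .
  show "((\<lambda>t. L *v v t) \<longlongrightarrow> 0) at_top"
    unfolding L by (rule laplacian_tendsto_zero[OF v_cons])

  \<comment> \<open>Uniform bound on the state\<close>
  fix S1 :: "'a^3^3" and S2 :: "'b^3^3"
  define A where "A = companion3 aI ap av"
  assume "diagonalizes S1 (map_matrix of_real (companion3 aI ap av))"
    and "diagonalizes S2 (map_matrix of_real (companion3 aI ap av))"
  then have S1: "diagonalizes S1 (map_matrix of_real A)"
    and S2: "diagonalizes S2 (map_matrix of_real A)"
    by (simp_all add: A_def)
  have A: "A = companion3 (p1 * p2 * p3) (p1 * p2 + p1 * p3 + p2 * p3) (p1 + p2 + p3)"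
    by (simp add: A_def aI ap av)
  define c where "c j t = (vector [zs t, y t, v t] :: real^'n^3) $ j" for j t
  have "serial_flow A L c"
    unfolding serial_flow_def
  proof (intro allI impI)
    fix t :: real and j i assume t: "t \<ge> 0"
    have "(c j has_vector_derivative (\<Sum>k\<in>UNIV. A $ j $ k *\<^sub>R (L *v c k t))) (at t within {0..})"
      using exhaust_3[of j] zs'[OF t] y'[OF t] v'[OF t]
      by (auto simp: c_def[abs_def] sum_3 A_def companion3_def)
    from bounded_linear.has_vector_derivative[OF bounded_linear_vec_nth this, of i]
    show "((\<lambda>t. c j t $ i) has_real_derivative (\<Sum>k\<in>UNIV. A $ j $ k * (L *v c k t) $ i))
        (at t within {0..})"
      by (simp add: has_real_derivative_iff_has_vector_derivative)
  qed
  then have flow: "serial_flow A L (\<lambda>j t. c j t + \<zeta> j t)" if "serial_flow A L \<zeta>" for \<zeta>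
    using that by (rule serial_flow_add)
  \<comment> \<open>This initial value undoes the shift in \<open>zs\<close>, so
    \<open>c + \<zeta>\<close> starts at the blocks of \<open>\<xi> 0\<close>.\<close>
  obtain \<zeta> where \<zeta>: "serial_flow A L \<zeta>"
    and \<zeta>0: "\<And>j. \<zeta> j 0 = (if j = 1 then (1 / aI) *\<^sub>R w0 else 0)"
    using serial_flow_exists[where ?c0.0 = "\<lambda>j. if j = 1 then (1 / aI) *\<^sub>R w0 else 0"] by blast

  define R1 R2 where "R1 = matrix_inv S1" and "R2 = matrix_inv S2"
  let ?e1 = "vector [1, 0, 0] :: 'a^3"
  have "norm ((R2 *v (\<chi> j. of_real ((c j 0 + \<zeta> j 0) $ i))) $ k) \<le>
      mat_norm_inf R2 * vec_norm_inf (\<xi> 0)" for i k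
  proof (rule norm_matrix_vector_mult_nth_le)
    fix j :: 3
    have "(c j 0 + \<zeta> j 0) $ i = \<xi> 0 $ (if j = 1 then Inl i else if j = 2 then Inr (Inl i) else Inr (Inr i))"
      using exhaust_3[of j]
      by (auto simp: \<xi> consensus_state_def stack3_def c_def zs_def y_def \<zeta>0)
    then show "norm ((\<chi> j. (of_real ((c j 0 + \<zeta> j 0) $ i) :: 'b)) $ j) \<le> vec_norm_inf (\<xi> 0)"
      by (simp only: vec_lambda_beta norm_of_real) (metis norm_nth_le_vec_norm_inf real_norm_def)
  qed
  from serial_flow_bound[OF A flow[OF \<zeta>, unfolded L] S2 W pos this[unfolded R2_def]]
  have c\<zeta>: "\<bar>(c j t + \<zeta> j t) $ i\<bar> \<le> mat_norm_inf S2 * (mat_norm_inf R2 * vec_norm_inf (\<xi> 0))"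
    if "t \<ge> 0" for j t i
    using that by (simp add: R2_def)

  \<comment> \<open>At each vertex \<open>\<zeta>\<close> starts at a multiple of
    \<open>?e1\<close>, so only the first column of \<open>R1\<close> enters its bound.\<close>
  have R1_col: "(R1 *v ?e1) $ k = R1 $ k $ 1" for k
    by (simp add: matrix_vector_mult_def sum_3)
  define r where "r = vec_norm_inf (R1 *v ?e1)"
  define m where "m = vec_norm_inf w0 / aI"
  have m: "\<bar>w0 $ i / aI\<bar> \<le> m" for i
    using norm_nth_le_vec_norm_inf[of w0 i] aI0 by (simp add: m_def divide_right_mono)
  have "norm ((R1 *v (\<chi> j. of_real (\<zeta> j 0 $ i))) $ k) \<le> r * m" for i k
  proof -
    have "(R1 *v (\<chi> j. of_real (\<zeta> j 0 $ i))) $ k = (R1 *v ?e1) $ k * of_real (w0 $ i / aI)"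
      unfolding R1_col by (simp add: matrix_vector_mult_def sum_3 \<zeta>0)
    also have "norm \<dots> \<le> r * m"
      unfolding norm_mult norm_of_real r_def
      by (intro mult_mono norm_nth_le_vec_norm_inf m vec_norm_inf_nonneg) auto
    finally show ?thesis .
  qed
  from serial_flow_bound[OF A \<zeta>[unfolded L] S1 W pos this[unfolded R1_def]]
  have \<zeta>_le: "\<bar>\<zeta> j t $ i\<bar> \<le> mat_norm_inf S1 * (r * m)" if "t \<ge> 0" for j t i
    using that by (simp add: R1_def)

  \<comment> \<open>This identity gives \<open>1 \<le> mat_norm_inf S1 * r\<close>, which lets the
    constant shift \<open>w0 / aI\<close> be bounded by the same quantity as \<open>\<zeta>\<close>.
    The two equal contributions are the source of the factor 2.\<close>
  have "S1 *v (R1 *v ?e1) = ?e1"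
    using S1 by (simp add: R1_def matrix_vector_mul_assoc matrix_inv_right_mult diagonalizes_def)
  then have "norm (?e1 $ 1) \<le> mat_norm_inf S1 * r"
    unfolding r_def by (metis norm_matrix_vector_mult_nth_le norm_nth_le_vec_norm_inf)
  then have "1 \<le> mat_norm_inf S1 * r" by simp
  moreover have "m \<ge> 0" using aI0 by (simp add: m_def vec_norm_inf_nonneg)
  ultimately have m_le: "m \<le> mat_norm_inf S1 * r * m" by (simp add: mult_le_cancel_right1)

  have "vec_norm_inf (\<xi> t) \<le> mat_norm_inf S2 * mat_norm_inf R2 * vec_norm_inf (\<xi> 0) +
      2 / (p1 * p2 * p3) * mat_norm_inf S1 * r * vec_norm_inf w0" if t: "t \<ge> 0" for t
  proof (rule vec_norm_inf_le)
    fix k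
    have "\<exists>j i. \<xi> t $ k = c j t $ i + (if j = 1 then w0 $ i / aI else 0)"
    proof (cases k)
      case (Inl i)
      then show ?thesis
        by (intro exI[of _ 1] exI[of _ i])
           (simp add: \<xi> consensus_state_def stack3_def c_def zs_def)
    next
      case (Inr l)
      then show ?thesis
      proof (cases l)
        case (Inl i)
        with Inr show ?thesis
          by (intro exI[of _ 2] exI[of _ i])
             (simp add: \<xi> consensus_state_def stack3_def c_def y_def)
      next
        case (Inr i)
        with \<open>k = Inr l\<close> show ?thesis
          by (intro exI[of _ 3] exI[of _ i])
             (simp add: \<xi> consensus_state_def stack3_def c_def)
      qed
    qed
    then obtain j i where ji: "\<xi> t $ k = c j t $ i + (if j = 1 then w0 $ i / aI else 0)" by blast
    \<comment> \<open>The entry is written as \<open>(c + \<zeta>) - \<zeta>\<close> plus the shift,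
      which is present only in the first block.\<close>
    have "\<bar>\<xi> t $ k\<bar> \<le> \<bar>(c j t + \<zeta> j t) $ i\<bar> + \<bar>\<zeta> j t $ i\<bar> + \<bar>w0 $ i / aI\<bar>"
      unfolding ji vector_add_component by (cases "j = 1"; simp del: abs_divide)
    also have "\<dots> \<le> mat_norm_inf S2 * (mat_norm_inf R2 * vec_norm_inf (\<xi> 0)) +
        mat_norm_inf S1 * (r * m) + mat_norm_inf S1 * r * m"
      by (intro add_mono c\<zeta> \<zeta>_le t order_trans[OF m m_le])
    finally show "norm (\<xi> t $ k) \<le> mat_norm_inf S2 * mat_norm_inf R2 * vec_norm_inf (\<xi> 0) +
        2 / (p1 * p2 * p3) * mat_norm_inf S1 * r * vec_norm_inf w0"
      by (simp add: m_def aI mult_ac)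
  qed
  then show "(SUP t\<in>{0..}. ereal (vec_norm_inf (\<xi> t))) \<le>
      ereal (mat_norm_inf S2 * mat_norm_inf (matrix_inv S2) * vec_norm_inf (\<xi> 0) +
             2 / (p1 * p2 * p3) * mat_norm_inf S1 *
               vec_norm_inf (matrix_inv S1 *v vector [1, 0, 0]) * vec_norm_inf w0)"
    by (intro SUP_least) (simp add: R1_def R2_def r_def)
qed

end
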